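(* (a) Let $(g):0\to\mathfrak n\xrightarrow{\chi}\mathfrak g\xrightarrow{\pi}\mathfrak q\to0$ be a $\mathsf{Lie}$-central extension of Leibniz algebras and $\mathrm{Autcl}(g)$ its group of $\mathsf{Lie}$-autoclinisms. Then $$\mathrm{Autcl}(g)\cong\{\eta\in\mathrm{Aut}(\mathfrak q) : \mathrm{HL}_2^{\mathsf{Lie}}(\eta)(\ker\theta(g))=\ker\theta(g)\}.$$ (b) If $(g)$ is a quasi $\mathsf{Lie}$-trivial extension, then $\mathrm{Autcl}(g)\cong\mathrm{Aut}(\mathfrak q)$. (c) Any two quasi $\mathsf{Lie}$-trivial extensions of a given Leibniz algebra are $\mathsf{Lie}$-isoclinic.
   Context: $\mathbb K$ is a field with $\frac12\in\mathbb K$. A Leibniz algebra is a $\mathbb K$-vector space $\mathfrak q$ with a bilinear bracket satisfying $[x,[y,z]]=[[x,y],z]-[[x,z],y]$; homomorphisms are linear maps preserving the bracket. For two-sided ideals $\mathfrak m,\mathfrak n$ of $\mathfrak q$, $[\mathfrak m,\mathfrak n]_{\mathsf{Lie}}$ is the two-sided ideal of $\mathfrak q$ generated by $\{[m,n]+[n,m] : m\in\mathfrak m,n\in\mathfrak n\}$, and $Z_{\mathsf{Lie}}(\mathfrak q)=\{z\in\mathfrak q : [q,z]+[z,q]=0\ \forall q\in\mathfrak q\}$ (a two-sided ideal). An extension (short exact sequence of Leibniz algebras) $(g):0\to\mathfrak n\xrightarrow{\chi}\mathfrak g\xrightarrow{\pi}\mathfrak q\to0$ (an extension of $\mathfrak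 q$) is $\mathsf{Lie}$-central if $\chi(\mathfrak n)\subseteq Z_{\mathsf{Lie}}(\mathfrak g)$, equivalently $[\chi(\mathfrak n),\mathfrak g]_{\mathsf{Lie}}=0$. Its $\mathsf{Lie}$-commutator map is the well-defined map $C:\mathfrak q\times\mathfrak q\to[\mathfrak g,\mathfrak g]_{\mathsf{Lie}}$, $C(q_1,q_2)=[x_1,x_2]+[x_2,x_1]$ where $\pi(x_j)=q_j$. A $\mathsf{Lie}$-isoclinism from $(g_1)$ to $(g_2)$ (with commutator maps $C_1,C_2$) is a pair $(\eta,\xi)$ of isomorphisms $\eta:\mathfrak q_1\to\mathfrak q_2$, $\xi:[\mathfrak g_1,\mathfrak g_1]_{\mathsf{Lie}}\to[\mathfrak g_2,\mathfrak g_2]_{\mathsf{Lie}}$ with $\xi\circ C_1=C_2\circ(\eta\times\eta)$; if one exists, the extensions are $\mathsf{Lie}$-isoclinic. $\mathrm{Autcl}(g)$ is the group (under componentwise composition) of $\mathsf{Lie}$-isoclinisms from $(g)$ to itself ($\mathsf{Lie}$-autoclinisms). $\mathsf{Lie}$-homology: for a free presentation $0\to\mathfrak r\to\mathfrak f\xrightarrow{\rho}\mathfrak q\to0$ of $\mathfrak q$ ($\mathfrak f$ a free Leibniz algebra), $\mathrm{HL}_2^{\mathsf{Lie}}(\mathfrak q)=\dfrac{\mathfrak r\cap[\mathfrak f,\mathfrak f]_{\mathsf{Lie}}}{[\mathfrak r,\mathfrak f]_{\mathsf{Lie}}}$ (independent of the presentation up to canonical isomorphism); it is functorial: $\mathrm{HL}_2^{\mathsf{Lie}}(\gamma)$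 is induced by any lift of $\gamma$ to a homomorphism between the free Leibniz algebras of the presentations. For a $\mathsf{Lie}$-central extension $(g)$, $\theta(g):\mathrm{HL}_2^{\mathsf{Lie}}(\mathfrak q)\to\mathfrak n$ is the natural connecting homomorphism of the exact sequence $\mathfrak n\otimes\mathfrak g_{\mathsf{Lie}}\to\mathrm{HL}_2^{\mathsf{Lie}}(\mathfrak g)\to\mathrm{HL}_2^{\mathsf{Lie}}(\mathfrak q)\xrightarrow{\theta(g)}\mathfrak n\to\mathfrak g_{\mathsf{Lie}}\to\mathfrak q_{\mathsf{Lie}}\to0$ (with $\mathfrak g_{\mathsf{Lie}}=\mathfrak g/[\mathfrak g,\mathfrak g]_{\mathsf{Lie}}$): choosing a lift $\tilde\rho:\mathfrak f\to\mathfrak g$ of $\rho$ (so $\pi\tilde\rho=\rho$), it sends the class of $r\in\mathfrak r\cap[\mathfrak f,\mathfrak f]_{\mathsf{Lie}}$ to $\chi^{-1}(\tilde\rho(r))$. A quasi $\mathsf{Lie}$-trivial extension is a $\mathsf{Lie}$-central extension $(g)$ such that $\theta(g)$ is a monomorphism. *)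

theory Defs
  imports Complex_Main "HOL-Library.FuncSet" "HOL-Algebra.Group"
begin

section \<open>Leibniz algebras\<close>

record ('k, 'a) leibniz =
  scale :: "'k \<Rightarrow> 'a \<Rightarrow> 'a"
  bracket :: "'a \<Rightarrow> 'a \<Rightarrow> 'a"

locale leibniz_algebra = vector_space "scale L"
  for L :: "('k::field, 'a::ab_group_add) leibniz" +
  assumes linear_left: "Vector_Spaces.linear (scale L) (scale L) (\<lambda>x. bracket L x y)"
    and linear_right: "Vector_Spaces.linear (scale L) (scale L) (\<lambda>y. bracket L x y)"
    and leibniz_id:
      "bracket L x (bracket L y z) = bracket L (bracket L x y) z - bracket L (bracket L x z) y"

definition leibniz_hom ::
  "('k::field, 'a::ab_group_add) leibniz \<Rightarrow> ('k, 'b::ab_group_add) leibniz \<Rightarrow> ('a \<Rightarrow> 'b) \<Rightarrow> bool"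
  where "leibniz_hom L M f \<longleftrightarrow>
    leibniz_algebra L \<and> leibniz_algebra M \<and> Vector_Spaces.linear (scale L) (scale M) f \<and>
    (\<forall>x y. f (bracket L x y) = bracket M (f x) (f y))"

definition leibniz_iso ::
  "('k::field, 'a::ab_group_add) leibniz \<Rightarrow> ('k, 'b::ab_group_add) leibniz \<Rightarrow> ('a \<Rightarrow> 'b) \<Rightarrow> bool"
  where "leibniz_iso L M f \<longleftrightarrow> leibniz_hom L M f \<and> bij f"

definition ideal :: "('k::field, 'a::ab_group_add) leibniz \<Rightarrow> 'a set \<Rightarrow> bool"
  where "ideal L I \<longleftrightarrow>
    module.subspace (scale L) I \<and> (\<forall>x\<in>I. \<forall>y. bracket L x y \<in> I \<and> bracket L y x \<in> I)"

text \<open>Isomorphisms between subalgebras \<open>A\<close> of \<open>L\<close> and \<open>B\<close> of \<open>M\<close>, as maps on the carriers.\<close>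

definition subalgebra_iso ::
  "('k::field, 'a::ab_group_add) leibniz \<Rightarrow> 'a set \<Rightarrow>
   ('k, 'b::ab_group_add) leibniz \<Rightarrow> 'b set \<Rightarrow> ('a \<Rightarrow> 'b) \<Rightarrow> bool"
  where "subalgebra_iso L A M B f \<longleftrightarrow>
    bij_betw f A B \<and>
    (\<forall>x\<in>A. \<forall>y\<in>A. f (x + y) = f x + f y) \<and>
    (\<forall>c. \<forall>x\<in>A. f (scale L c x) = scale M c (f x)) \<and>
    (\<forall>x\<in>A. \<forall>y\<in>A. f (bracket L x y) = bracket M (f x) (f y))"

definition lie_commutator ::
  "('k::field, 'a::ab_group_add) leibniz \<Rightarrow> 'a set \<Rightarrow> 'a set \<Rightarrow> 'a set"
  where "lie_commutator L M N =
    ideal L hull {bracket L m n + bracket L n m | m n. m \<in> M \<and> n \<in> N}"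

definition lie_center :: "('k::field, 'a::ab_group_add) leibniz \<Rightarrow> 'a set"
  where "lie_center L = {z. \<forall>q. bracket L q z + bracket L z q = 0}"

definition Aut :: "('k::field, 'a::ab_group_add) leibniz \<Rightarrow> ('a \<Rightarrow> 'a) monoid"
  where "Aut L = \<lparr>carrier = {f. leibniz_iso L L f}, mult = (\<circ>), one = id\<rparr>"

section \<open>Extensions and Lie-isoclinism\<close>

record ('k, 'n, 'g, 'q) extension =
  ext_ker :: "('k, 'n) leibniz"
  ext_mid :: "('k, 'g) leibniz"
  ext_quot :: "('k, 'q) leibniz"
  ext_incl :: "'n \<Rightarrow> 'g"
  ext_proj :: "'g \<Rightarrow> 'q"

definition is_extension ::
  "('k::field, 'n::ab_group_add, 'g::ab_group_add, 'q::ab_group_add) extension \<Rightarrow> bool"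
  where "is_extension E \<longleftrightarrow>
    leibniz_hom (ext_ker E) (ext_mid E) (ext_incl E) \<and>
    leibniz_hom (ext_mid E) (ext_quot E) (ext_proj E) \<and>
    inj (ext_incl E) \<and> surj (ext_proj E) \<and>
    range (ext_incl E) = {x. ext_proj E x = 0}"

definition lie_central ::
  "('k::field, 'n::ab_group_add, 'g::ab_group_add, 'q::ab_group_add) extension \<Rightarrow> bool"
  where "lie_central E \<longleftrightarrow> is_extension E \<and> range (ext_incl E) \<subseteq> lie_center (ext_mid E)"

abbreviation ext_comm ::
  "('k::field, 'n::ab_group_add, 'g::ab_group_add, 'q::ab_group_add) extension \<Rightarrow> 'g set"
  where "ext_comm E \<equiv> lie_commutator (ext_mid E) UNIV UNIV"

text \<open>The description below has a unique solution when the extension is Lie-central.\<close>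

definition commutator_map ::
  "('k::field, 'n::ab_group_add, 'g::ab_group_add, 'q::ab_group_add) extension
    \<Rightarrow> 'q \<Rightarrow> 'q \<Rightarrow> 'g"
  where "commutator_map E q1 q2 =
    (THE c. \<exists>x1 x2. ext_proj E x1 = q1 \<and> ext_proj E x2 = q2 \<and>
       c = bracket (ext_mid E) x1 x2 + bracket (ext_mid E) x2 x1)"

text \<open>
  The map \<open>\<xi>\<close> lives on a subset of a type; it is taken to be \<open>undefined\<close> outside of it, so that
  equality of isoclinisms is equality of maps on their domains.
\<close>

definition lie_isoclinism ::
  "('k::field, 'n1::ab_group_add, 'g1::ab_group_add, 'q1::ab_group_add) extension \<Rightarrow>
   ('k, 'n2::ab_group_add, 'g2::ab_group_add, 'q2::ab_group_add) extension \<Rightarrow>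
   ('q1 \<Rightarrow> 'q2) \<times> ('g1 \<Rightarrow> 'g2) \<Rightarrow> bool"
  where "lie_isoclinism E1 E2 = (\<lambda>(\<eta>, \<xi>).
    leibniz_iso (ext_quot E1) (ext_quot E2) \<eta> \<and>
    subalgebra_iso (ext_mid E1) (ext_comm E1) (ext_mid E2) (ext_comm E2) \<xi> \<and>
    \<xi> \<in> extensional (ext_comm E1) \<and>
    (\<forall>a b. \<xi> (commutator_map E1 a b) = commutator_map E2 (\<eta> a) (\<eta> b)))"

definition lie_isoclinic ::
  "('k::field, 'n1::ab_group_add, 'g1::ab_group_add, 'q1::ab_group_add) extension \<Rightarrow>
   ('k, 'n2::ab_group_add, 'g2::ab_group_add, 'q2::ab_group_add) extension \<Rightarrow> bool"
  where "lie_isoclinic E1 E2 \<longleftrightarrow> (\<exists>p. lie_isoclinism E1 E2 p)"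

definition Autcl ::
  "('k::field, 'n::ab_group_add, 'g::ab_group_add, 'q::ab_group_add) extension \<Rightarrow>
   (('q \<Rightarrow> 'q) \<times> ('g \<Rightarrow> 'g)) monoid"
  where "Autcl E = \<lparr>carrier = {p. lie_isoclinism E E p},
    mult = (\<lambda>(\<eta>1, \<xi>1) (\<eta>2, \<xi>2). (\<eta>1 \<circ> \<eta>2, compose (ext_comm E) \<xi>1 \<xi>2)),
    one = (id, restrict id (ext_comm E))\<rparr>"

section \<open>Free Leibniz algebras\<close>

text \<open>
  The free Leibniz algebra on a set \<open>X\<close> consists of the formal terms over \<open>X\<close>, modulo the smallest
  congruence that makes the axioms of a Leibniz algebra hold.  Scaling by \<open>-1\<close> plays the role
  of negation.
\<close>

datatype (dead 'k, gens: 'x) leibniz_term =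
    Gen 'x
  | Zero
  | Add "('k, 'x) leibniz_term" "('k, 'x) leibniz_term"
  | Scale 'k "('k, 'x) leibniz_term"
  | Br "('k, 'x) leibniz_term" "('k, 'x) leibniz_term"

inductive leibniz_eq :: "('k::field, 'x) leibniz_term \<Rightarrow> ('k, 'x) leibniz_term \<Rightarrow> bool"
  where
    refl: "leibniz_eq s s"
  | sym: "leibniz_eq s t \<Longrightarrow> leibniz_eq t s"
  | trans: "leibniz_eq s t \<Longrightarrow> leibniz_eq t u \<Longrightarrow> leibniz_eq s u"
  | cong_Add: "leibniz_eq s s' \<Longrightarrow> leibniz_eq t t' \<Longrightarrow> leibniz_eq (Add s t) (Add s' t')"
  | cong_Scale: "leibniz_eq s s' \<Longrightarrow> leibniz_eq (Scale a s) (Scale a s')"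
  | cong_Br: "leibniz_eq s s' \<Longrightarrow> leibniz_eq t t' \<Longrightarrow> leibniz_eq (Br s t) (Br s' t')"
  | Add_assoc: "leibniz_eq (Add (Add s t) u) (Add s (Add t u))"
  | Add_commute: "leibniz_eq (Add s t) (Add t s)"
  | Add_Zero: "leibniz_eq (Add Zero s) s"
  | Scale_zero: "leibniz_eq (Scale 0 s) Zero"
  | Scale_one: "leibniz_eq (Scale 1 s) s"
  | Scale_Scale: "leibniz_eq (Scale a (Scale b s)) (Scale (a * b) s)"
  | Scale_Add: "leibniz_eq (Scale a (Add s t)) (Add (Scale a s) (Scale a t))"
  | Scale_add: "leibniz_eq (Scale (a + b) s) (Add (Scale a s) (Scale b s))"
  | Br_Add_left: "leibniz_eq (Br (Add s t) u) (Add (Br s u) (Br t u))"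
  | Br_Add_right: "leibniz_eq (Br s (Add t u)) (Add (Br s t) (Br s u))"
  | Br_Scale_left: "leibniz_eq (Br (Scale a s) t) (Scale a (Br s t))"
  | Br_Scale_right: "leibniz_eq (Br s (Scale a t)) (Scale a (Br s t))"
  | Leibniz: "leibniz_eq (Br s (Br t u)) (Add (Br (Br s t) u) (Scale (- 1) (Br (Br s u) t)))"

primrec eval_term ::
  "('k, 'a::ab_group_add) leibniz \<Rightarrow> ('x \<Rightarrow> 'a) \<Rightarrow> ('k, 'x) leibniz_term \<Rightarrow> 'a"
  where
    "eval_term L \<phi> (Gen x) = \<phi> x"
  | "eval_term L \<phi> Zero = 0"
  | "eval_term L \<phi> (Add s t) = eval_term L \<phi> s + eval_term L \<phi> t"
  | "eval_term L \<phi> (Scale a s) = scale L a (eval_term L \<phi> s)"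
  | "eval_term L \<phi> (Br s t) = bracket L (eval_term L \<phi> s) (eval_term L \<phi> t)"

text \<open>
  \<open>L\<close> is free on its subset \<open>X\<close>: evaluation induces an isomorphism onto \<open>L\<close> from the terms
  over \<open>X\<close> modulo the Leibniz algebra axioms.
\<close>

definition free_leibniz_on :: "('k::field, 'a::ab_group_add) leibniz \<Rightarrow> 'a set \<Rightarrow> bool"
  where "free_leibniz_on L X \<longleftrightarrow>
    leibniz_algebra L \<and>
    (\<forall>x. \<exists>t. gens t \<subseteq> X \<and> eval_term L id t = x) \<and>
    (\<forall>s t. gens s \<subseteq> X \<longrightarrow> gens t \<subseteq> X \<longrightarrow> eval_term L id s = eval_term L id t
      \<longrightarrow> leibniz_eq s t)"

context leibniz_algebra
begin

lemma bracket_simps: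
  "bracket L (x + y) z = bracket L x z + bracket L y z"
  "bracket L x (y + z) = bracket L x y + bracket L x z"
  "bracket L (scale L a x) y = scale L a (bracket L x y)"
  "bracket L x (scale L a y) = scale L a (bracket L x y)"
  using linear_left linear_right
  by (simp_all add: Vector_Spaces.linear_iff)

lemma eval_term_leibniz_eq: "leibniz_eq s t \<Longrightarrow> eval_term L \<phi> s = eval_term L \<phi> t"
  by (induction rule: leibniz_eq.induct)
    (simp_all add: bracket_simps scale_left_distrib scale_right_distrib add.assoc add.commute leibniz_id)

end

text \<open>The universal property:\<close>

lemma free_leibniz_on_universal:
  fixes L :: "('k::field, 'a::ab_group_add) leibniz" and M :: "('k, 'b::ab_group_add) leibniz"
  assumes free: "free_leibniz_on L X" and M: "leibniz_algebra M"
  shows "\<exists>!f. leibniz_hom L M f \<and> (\<forall>x\<in>X. f x = \<phi> x)"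
proof -
  have L: "leibniz_algebra L" using free by (simp add: free_leibniz_on_def)
  interpret L: leibniz_algebra L by fact
  interpret M: leibniz_algebra M by fact
  have ex: "\<exists>t. gens t \<subseteq> X \<and> eval_term L id t = x" for x
    using free by (simp add: free_leibniz_on_def)
  define f where "f x = eval_term M \<phi> (SOME t. gens t \<subseteq> X \<and> eval_term L id t = x)" for x
  have f: "f (eval_term L id t) = eval_term M \<phi> t" if t: "gens t \<subseteq> X" for t
  proof -
    define s where "s = (SOME s. gens s \<subseteq> X \<and> eval_term L id s = eval_term L id t)"
    have s: "gens s \<subseteq> X \<and> eval_term L id s = eval_term L id t"
      unfolding s_def by (rule someI_ex) (rule ex)
    then have "leibniz_eq s t" using free t unfolding free_leibniz_on_def by blast
    then show ?thesis using M.eval_term_leibniz_eq by (simp add: f_def s_def)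
  qed
  have "f (x + y) = f x + f y \<and> f (bracket L x y) = bracket M (f x) (f y) \<and>
      f (scale L a x) = scale M a (f x)" for x y a
  proof -
    obtain s t where "gens s \<subseteq> X" "eval_term L id s = x" "gens t \<subseteq> X" "eval_term L id t = y"
      using ex by metis
    then show ?thesis using f[of s] f[of t] f[of "Add s t"] f[of "Br s t"] f[of "Scale a s"] by simp
  qed
  then have hom: "leibniz_hom L M f"
    using L M L.vector_space_axioms M.vector_space_axioms
    by (simp add: leibniz_hom_def Vector_Spaces.linear_iff)
  have gen: "f x = \<phi> x" if "x \<in> X" for x using f[of "Gen x"] that by simp
  have uniq: "g x = f x" if g: "leibniz_hom L M g" "\<forall>x\<in>X. g x = \<phi> x" for g x
  proof -
    have lin: "Vector_Spaces.linear (scale L) (scale M) g"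
      and br: "g (bracket L x y) = bracket M (g x) (g y)" for x y
      using g by (auto simp: leibniz_hom_def)
    have add: "g (x + y) = g x + g y" and sc: "g (scale L a x) = scale M a (g x)" for x y a
      using lin by (auto simp: Vector_Spaces.linear_iff)
    have zero: "g 0 = 0" using add[of 0 0] by simp
    have "gens t \<subseteq> X \<Longrightarrow> g (eval_term L id t) = eval_term M \<phi> t" for t
      by (induction t) (use g in \<open>auto simp: add sc br zero\<close>)
    then show ?thesis using ex[of x] f by metis
  qed
  show ?thesis
  proof (rule ex1I[of _ f])
    show "leibniz_hom L M f \<and> (\<forall>x\<in>X. f x = \<phi> x)" using hom gen by simp
  qed (use uniq in auto)
qed

definition free_presentation ::
  "('k::field, 'f::ab_group_add) leibniz \<Rightarrow> ('f \<Rightarrow> 'q::ab_group_add) \<Rightarrow> ('k, 'q) leibniz \<Rightarrow> bool"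
  where "free_presentation F \<rho> Q \<longleftrightarrow>
    (\<exists>X. free_leibniz_on F X) \<and> leibniz_hom F Q \<rho> \<and> surj \<rho>"

section \<open>The second Lie-homology\<close>

abbreviation rel_ker :: "('f \<Rightarrow> 'q::zero) \<Rightarrow> 'f set"
  where "rel_ker \<rho> \<equiv> {x. \<rho> x = 0}"

definition coset :: "'a::ab_group_add set \<Rightarrow> 'a \<Rightarrow> 'a set"
  where "coset I x = (\<lambda>i. x + i) ` I"

text \<open>
  For a free presentation \<open>\<rho>\<close> with domain \<open>F\<close>, the quotient is represented by the set of cosets.
\<close>

definition HL2 ::
  "('k::field, 'f::ab_group_add) leibniz \<Rightarrow> ('f \<Rightarrow> 'q::ab_group_add) \<Rightarrow> 'f set set"
  where "HL2 F \<rho> =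
    coset (lie_commutator F (rel_ker \<rho>) UNIV) ` (rel_ker \<rho> \<inter> lie_commutator F UNIV UNIV)"

text \<open>
  The induced map does not depend on the lift \<open>t\<close> of \<open>\<gamma>\<close> nor on the representative \<open>x\<close>, so the
  description has a unique solution on \<open>HL2 F1 \<rho>1\<close>.  The same applies to
  \<open>theta\<close> for Lie-central extensions.
\<close>

definition HL2_map ::
  "('k::field, 'f1::ab_group_add) leibniz \<Rightarrow> ('f1 \<Rightarrow> 'q1::ab_group_add) \<Rightarrow>
   ('k, 'f2::ab_group_add) leibniz \<Rightarrow> ('f2 \<Rightarrow> 'q2::ab_group_add) \<Rightarrow>
   ('q1 \<Rightarrow> 'q2) \<Rightarrow> 'f1 set \<Rightarrow> 'f2 set"
  where "HL2_map F1 \<rho>1 F2 \<rho>2 \<gamma> c =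
    (THE d. \<exists>t x. leibniz_hom F1 F2 t \<and> (\<forall>y. \<rho>2 (t y) = \<gamma> (\<rho>1 y)) \<and> x \<in> c \<and>
       d = coset (lie_commutator F2 (rel_ker \<rho>2) UNIV) (t x))"

definition theta ::
  "('k::field, 'f::ab_group_add) leibniz \<Rightarrow> ('f \<Rightarrow> 'q::ab_group_add) \<Rightarrow>
   ('k, 'n::ab_group_add, 'g::ab_group_add, 'q) extension \<Rightarrow> 'f set \<Rightarrow> 'n"
  where "theta F \<rho> E c =
    (THE n. \<exists>t x. leibniz_hom F (ext_mid E) t \<and> (\<forall>y. ext_proj E (t y) = \<rho> y) \<and> x \<in> c \<and>
       ext_incl E n = t x)"

definition ker_theta ::
  "('k::field, 'f::ab_group_add) leibniz \<Rightarrow> ('f \<Rightarrow> 'q::ab_group_add) \<Rightarrow>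
   ('k, 'n::ab_group_add, 'g::ab_group_add, 'q) extension \<Rightarrow> 'f set set"
  where "ker_theta F \<rho> E = {c \<in> HL2 F \<rho>. theta F \<rho> E c = 0}"

text \<open>As \<open>theta\<close> is a homomorphism, it is a monomorphism iff it is injective.\<close>

definition quasi_lie_trivial ::
  "('k::field, 'f::ab_group_add) leibniz \<Rightarrow> ('f \<Rightarrow> 'q::ab_group_add) \<Rightarrow>
   ('k, 'n::ab_group_add, 'g::ab_group_add, 'q) extension \<Rightarrow> bool"
  where "quasi_lie_trivial F \<rho> E \<longleftrightarrow> lie_central E \<and> inj_on (theta F \<rho> E) (HL2 F \<rho>)"

end

theory Submission
  imports Defs
begin

text \<open>
  By the Leibniz identity the elements \<open>[m,n] + [n,m]\<close> span the ideal they generate.  Hence, for a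
  Lie-central extension of \<open>Q\<close>, a lift \<open>t\<close> of \<open>\<rho>\<close> to the free algebra \<open>F\<close> maps the Lie-commutator of
  \<open>F\<close> onto that of the middle term; its restriction does not depend on the choice of \<open>t\<close>, and its
  kernel \<open>K\<close> corresponds to the kernel of \<open>\<theta>\<close>.  If \<open>h\<close> is a lift of \<open>\<eta>\<close> to \<open>F\<close>, then the
  second component \<open>\<xi>\<close> of an isoclinism over \<open>\<eta>\<close> must satisfy \<open>\<xi> \<circ> t = t \<circ> h\<close> on the
  Lie-commutator of \<open>F\<close>; so \<open>\<xi>\<close> is unique, and it exists iff \<open>h\<close> preserves and reflects membership in
  \<open>K\<close>, which says that the induced map preserves the kernel of \<open>\<theta>\<close>.
\<close>

section \<open>Symmetrised brackets and the ideals they span\<close>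

definition sym_bracket :: "('k, 'a::ab_group_add) leibniz \<Rightarrow> 'a \<Rightarrow> 'a \<Rightarrow> 'a"
  where "sym_bracket L x y = bracket L x y + bracket L y x"

context leibniz_algebra
begin

lemma bracket_zero [simp]: "bracket L 0 x = 0" "bracket L x 0 = 0"
  using bracket_simps(1)[of 0 0 x] bracket_simps(2)[of x 0 0] by simp_all

lemma sym_bracket_add:
  "sym_bracket L (x + y) z = sym_bracket L x z + sym_bracket L y z"
  "sym_bracket L x (y + z) = sym_bracket L x y + sym_bracket L x z"
  by (simp_all add: sym_bracket_def bracket_simps)

text \<open>The Leibniz expansions of [x,[y,z]] and [x,[z,y]] are negatives of each other.\<close>

lemma bracket_sym_bracket_right: "bracket L x (sym_bracket L y z) = 0"
  by (simp add: sym_bracket_def bracket_simps leibniz_id)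

text \<open>By the Leibniz identity, bracketing with \<open>x\<close> on the right is a derivation
  of the bracket, hence of its symmetrisation.\<close>

lemma bracket_sym_bracket_left:
  "bracket L (sym_bracket L y z) x = sym_bracket L y (bracket L z x) + sym_bracket L (bracket L y x) z"
  by (simp add: sym_bracket_def bracket_simps leibniz_id)

text \<open>Left bracketing annihilates symmetrised brackets, and right bracketing, as a derivation,
  yields sums of symmetrised brackets with entries still in the ideals \<open>M\<close> and
  \<open>N\<close>. So the span is already an ideal.\<close>

lemma lie_commutator_eq_span:
  assumes M: "ideal L M" and N: "ideal L N"
  shows "lie_commutator L M N = span {sym_bracket L m n | m n. m \<in> M \<and> n \<in> N}" (is "_ = span ?D")
proof -
  have right: "bracket L x d = 0" if "d \<in> span ?D" for x d
    using that
    by (induction rule: span_induct_alt) (auto simp: bracket_simps bracket_sym_bracket_right)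
  have left: "bracket L d x \<in> span ?D" if "d \<in> span ?D" for x d
    using that
  proof (induction rule: span_induct_alt)
    case base
    show ?case by (simp add: span_zero)
  next
    case (step c d e)
    then obtain m n where d: "d = sym_bracket L m n" "m \<in> M" "n \<in> N" by blast
    have "bracket L n x \<in> N" "bracket L m x \<in> M" using d M N by (auto simp: ideal_def)
    then have "sym_bracket L m (bracket L n x) \<in> ?D" "sym_bracket L (bracket L m x) n \<in> ?D"
      using d by blast+
    then have "bracket L d x \<in> span ?D"
      unfolding d bracket_sym_bracket_left by (intro span_add span_base)
    with step show ?case by (simp add: bracket_simps span_add span_scale)
  qed
  have "ideal L hull ?D = span ?D"
  proof (rule hull_unique)
    show "ideal L (span ?D)"
      unfolding ideal_def using right left by (auto simp: span_zero)
    show "span ?D \<subseteq> I" if "?D \<subseteq> I" "ideal L I" for I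
      using that span_minimal unfolding ideal_def by blast
  qed (rule span_superset)
  then show ?thesis by (simp add: lie_commutator_def sym_bracket_def)
qed

lemma ideal_UNIV: "ideal L UNIV"
  by (simp add: ideal_def)

lemma ideal_lie_commutator: "ideal L (lie_commutator L M N)"
  unfolding lie_commutator_def
  by (rule hull_in) (auto simp: ideal_def subspace_def)

lemma sym_bracket_in_lie_commutator:
  "m \<in> M \<Longrightarrow> n \<in> N \<Longrightarrow> sym_bracket L m n \<in> lie_commutator L M N"
  unfolding lie_commutator_def sym_bracket_def by (rule hull_inc) blast

lemma lie_commutator_mono:
  "M \<subseteq> M' \<Longrightarrow> N \<subseteq> N' \<Longrightarrow> lie_commutator L M N \<subseteq> lie_commutator L M' N'"
  unfolding lie_commutator_def by (rule hull_mono) blast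

lemma lie_commutator_induct [consumes 3, case_names zero step]:
  assumes "x \<in> lie_commutator L M N" "ideal L M" "ideal L N" "P 0"
    "\<And>c m n y. m \<in> M \<Longrightarrow> n \<in> N \<Longrightarrow> y \<in> lie_commutator L M N \<Longrightarrow> P y
      \<Longrightarrow> P (scale L c (sym_bracket L m n) + y)"
  shows "P x"
proof -
  let ?D = "{sym_bracket L m n | m n. m \<in> M \<and> n \<in> N}"
  have eq: "lie_commutator L M N = span ?D" using assms by (intro lie_commutator_eq_span)
  have "x \<in> span ?D" using assms eq by simp
  \<comment> \<open>Carrying the span membership along supplies the assumption on \<open>y\<close>
    in the step case.\<close>
  then have "x \<in> span ?D \<and> P x"
    by (induction rule: span_induct_alt)
      (use assms eq in \<open>auto intro!: span_zero span_add span_scale intro: span_base\<close>)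
  then show ?thesis ..
qed

end

section \<open>Calculation rules for ideals and homomorphisms\<close>

lemma idealD:
  assumes "leibniz_algebra L" "ideal L I"
  shows ideal_zero: "0 \<in> I"
    and ideal_add: "x \<in> I \<Longrightarrow> y \<in> I \<Longrightarrow> x + y \<in> I"
    and ideal_diff: "x \<in> I \<Longrightarrow> y \<in> I \<Longrightarrow> x - y \<in> I"
    and ideal_scale: "x \<in> I \<Longrightarrow> scale L c x \<in> I"
    and ideal_bracket: "x \<in> I \<Longrightarrow> bracket L x z \<in> I"
proof -
  interpret leibniz_algebra L by fact
  show "0 \<in> I" "x \<in> I \<Longrightarrow> y \<in> I \<Longrightarrow> x + y \<in> I" "x \<in> I \<Longrightarrow> y \<in> I \<Longrightarrow> x - y \<in> I"
    "x \<in> I \<Longrightarrow> scale L c x \<in> I" "x \<in> I \<Longrightarrow> bracket L x z \<in> I"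
    using assms(2) unfolding ideal_def
    by (auto intro: subspace_0 subspace_add subspace_diff subspace_scale)
qed

lemma leibniz_homD:
  assumes "leibniz_hom L M f"
  shows leibniz_hom_source: "leibniz_algebra L"
    and leibniz_hom_target: "leibniz_algebra M"
    and leibniz_hom_add: "f (x + y) = f x + f y"
    and leibniz_hom_scale: "f (scale L c x) = scale M c (f x)"
    and leibniz_hom_bracket: "f (bracket L x y) = bracket M (f x) (f y)"
    and leibniz_hom_sym_bracket: "f (sym_bracket L x y) = sym_bracket M (f x) (f y)"
  using assms unfolding leibniz_hom_def sym_bracket_def by (auto simp: Vector_Spaces.linear_iff)

lemma leibniz_hom_zero: "leibniz_hom L M f \<Longrightarrow> f 0 = 0"
  using leibniz_hom_add[of L M f 0 0] by simp

lemma leibniz_hom_diff: "leibniz_hom L M f \<Longrightarrow> f (x - y) = f x - f y"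
  using leibniz_hom_add[of L M f "x - y" y] by simp

lemma leibniz_hom_comp:
  "leibniz_hom L M f \<Longrightarrow> leibniz_hom M N g \<Longrightarrow> leibniz_hom L N (g \<circ> f)"
  by (auto simp: leibniz_hom_def Vector_Spaces.linear_iff)

lemma leibniz_hom_id: "leibniz_algebra L \<Longrightarrow> leibniz_hom L L id"
  by (simp add: leibniz_hom_def Vector_Spaces.linear_iff leibniz_algebra_def)

lemma leibniz_iso_inverse:
  assumes "leibniz_iso L M f"
  obtains g where "leibniz_hom M L g" "\<And>x. g (f x) = x" "\<And>y. f (g y) = y"
proof -
  have f: "leibniz_hom L M f" and bij: "bij f" using assms by (auto simp: leibniz_iso_def)
  obtain g where gf: "\<And>x. g (f x) = x" and fg: "\<And>y. f (g y) = y"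
    using bij by (metis bij_pointE)
  have "g (x + y) = g x + g y" "g (scale M c x) = scale L c (g x)"
    "g (bracket M x y) = bracket L (g x) (g y)" for x y c
    using gf[of "g x + g y"] gf[of "scale L c (g x)"] gf[of "bracket L (g x) (g y)"]
    by (simp_all add: fg leibniz_homD[OF f])
  then have "leibniz_hom M L g"
    using f by (simp add: leibniz_hom_def Vector_Spaces.linear_iff)
  then show ?thesis using that gf fg by blast
qed

section \<open>Kernels, lifts from free algebras and images of Lie-commutators\<close>

lemma ideal_rel_ker:
  assumes "leibniz_hom L M f"
  shows "ideal L (rel_ker f)"
proof -
  interpret L: leibniz_algebra L by (rule leibniz_hom_source[OF assms])
  interpret M: leibniz_algebra M by (rule leibniz_hom_target[OF assms])
  show ?thesis
    by (simp add: ideal_def L.subspace_def leibniz_hom_zero[OF assms] leibniz_homD[OF assms])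
qed

text \<open>Freeness permits sending each generator to a \<open>p\<close>-preimage of its value
  under \<open>f\<close>, chosen by the section \<open>s\<close>. Then \<open>p \<circ> t\<close>
  and \<open>f\<close> agree on generators, so uniqueness makes them equal.\<close>

lemma free_leibniz_lift:
  assumes free: "free_leibniz_on F X" and f: "leibniz_hom F N f"
    and p: "leibniz_hom M N p" "surj p"
  obtains t where "leibniz_hom F M t" "\<And>y. p (t y) = f y"
proof -
  obtain s where s: "\<And>y. p (s y) = y" using p(2) by (metis surjD)
  obtain t where t: "leibniz_hom F M t" "\<forall>x\<in>X. t x = s (f x)"
    using free_leibniz_on_universal[OF free leibniz_hom_source[OF p(1)], of "\<lambda>x. s (f x)"]
    by blast
  have "p \<circ> t = f"
    using free_leibniz_on_universal[OF free leibniz_hom_target[OF f], of f]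
      leibniz_hom_comp[OF t(1) p(1)] f t(2) s
    by (metis comp_apply)
  then show ?thesis using that t(1) by (metis comp_apply)
qed

lemma leibniz_hom_lie_commutator:
  assumes f: "leibniz_hom L M f" and R: "ideal L R" and S: "\<And>r. r \<in> R \<Longrightarrow> f r \<in> S"
    and x: "x \<in> lie_commutator L R UNIV"
  shows "f x \<in> lie_commutator M S UNIV"
proof -
  interpret L: leibniz_algebra L by (rule leibniz_hom_source[OF f])
  interpret M: leibniz_algebra M by (rule leibniz_hom_target[OF f])
  note I = idealD[OF leibniz_hom_target[OF f] M.ideal_lie_commutator[of S UNIV]]
  from x R L.ideal_UNIV show ?thesis
    by (induction rule: L.lie_commutator_induct)
      (simp_all add: leibniz_hom_zero[OF f] leibniz_homD[OF f] I S M.sym_bracket_in_lie_commutator)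
qed

text \<open>Replacing \<open>f\<close> by \<open>g\<close> in one entry of a symmetrised bracket at
  a time costs only symmetrised brackets with an entry in \<open>R\<close>. Independence of the
  choice of a lift rests on this, with \<open>R\<close> the kernel in which two lifts
  differ.\<close>

lemma leibniz_hom_diff_lie_commutator:
  assumes f: "leibniz_hom L M f" and g: "leibniz_hom L M g"
    and R: "\<And>x. f x - g x \<in> R"
    and x: "x \<in> lie_commutator L UNIV UNIV"
  shows "f x - g x \<in> lie_commutator M R UNIV"
proof -
  interpret L: leibniz_algebra L by (rule leibniz_hom_source[OF f])
  interpret M: leibniz_algebra M by (rule leibniz_hom_target[OF f])
  note I = idealD[OF leibniz_hom_target[OF f] M.ideal_lie_commutator[of R UNIV]]
  from x L.ideal_UNIV L.ideal_UNIV show ?thesis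
  proof (induction rule: L.lie_commutator_induct)
    case zero
    show ?case by (simp add: leibniz_hom_zero[OF f] leibniz_hom_zero[OF g] I)
  next
    case (step c m n y)
    have "sym_bracket M (f m) (f n) - sym_bracket M (g m) (g n)
      = sym_bracket M (f m - g m) (f n) + sym_bracket M (f n - g n) (g m)"
      using M.sym_bracket_add(1)[of "f m - g m" "g m" "f n"]
        M.sym_bracket_add(1)[of "f n - g n" "g n" "g m"]
      by (simp add: sym_bracket_def add.commute)
    then have "sym_bracket M (f m) (f n) - sym_bracket M (g m) (g n) \<in> lie_commutator M R UNIV"
      by (simp add: I M.sym_bracket_in_lie_commutator R)
    then have "scale M c (sym_bracket M (f m) (f n) - sym_bracket M (g m) (g n)) + (f y - g y)
        \<in> lie_commutator M R UNIV"
      using step by (intro I(2) I(4))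
    then show ?case
      by (simp add: leibniz_homD[OF f] leibniz_homD[OF g] M.scale_right_diff_distrib algebra_simps)
  qed
qed

section \<open>Isoclinisms and lifts to a common algebra\<close>

lemma lie_centralD:
  assumes "lie_central E"
  shows lie_central_incl_hom: "leibniz_hom (ext_ker E) (ext_mid E) (ext_incl E)"
    and lie_central_proj_hom: "leibniz_hom (ext_mid E) (ext_quot E) (ext_proj E)"
    and lie_central_inj: "inj (ext_incl E)"
    and lie_central_surj: "surj (ext_proj E)"
    and lie_central_range: "range (ext_incl E) = rel_ker (ext_proj E)"
    and lie_central_sym_bracket: "ext_proj E z = 0 \<Longrightarrow> sym_bracket (ext_mid E) z x = 0"
  using assms
  by (auto simp: lie_central_def is_extension_def lie_center_def sym_bracket_def add.commute)

lemma lie_central_commutator_zero: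
  assumes E: "lie_central E" and x: "x \<in> lie_commutator (ext_mid E) (rel_ker (ext_proj E)) UNIV"
  shows "x = 0"
proof -
  note p = lie_central_proj_hom[OF E]
  interpret leibniz_algebra "ext_mid E" by (rule leibniz_hom_source[OF p])
  from x ideal_rel_ker[OF p] ideal_UNIV show ?thesis
    by (induction rule: lie_commutator_induct) (simp_all add: lie_central_sym_bracket[OF E])
qed

text \<open>Elements over the same point differ by a kernel element, which Lie-centrality removes
  from either slot. This makes the commutator map well defined.\<close>

lemma lie_central_sym_bracket_cong:
  assumes E: "lie_central E"
    and "ext_proj E x = ext_proj E x'" "ext_proj E y = ext_proj E y'"
  shows "sym_bracket (ext_mid E) x y = sym_bracket (ext_mid E) x' y'"
proof -
  note p = lie_central_proj_hom[OF E]
  interpret leibniz_algebra "ext_mid E" by (rule leibniz_hom_source[OF p])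
  have comm: "sym_bracket (ext_mid E) a b = sym_bracket (ext_mid E) b a" for a b
    by (simp add: sym_bracket_def add.commute)
  have 1: "sym_bracket (ext_mid E) a b = sym_bracket (ext_mid E) a' b"
    if "ext_proj E a = ext_proj E a'" for a a' b
    using sym_bracket_add(1)[of "a - a'" a' b] lie_central_sym_bracket[OF E, of "a - a'" b] that
    by (simp add: leibniz_hom_diff[OF p])
  show ?thesis using 1 assms comm by metis
qed

lemma commutator_map_eq:
  assumes E: "lie_central E"
  shows "commutator_map E (ext_proj E x) (ext_proj E y) = sym_bracket (ext_mid E) x y"
  unfolding commutator_map_def sym_bracket_def[symmetric]
proof (rule the_equality)
  show "c = sym_bracket (ext_mid E) x y"
    if "\<exists>x' y'. ext_proj E x' = ext_proj E x \<and> ext_proj E y' = ext_proj E y \<and>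
      c = sym_bracket (ext_mid E) x' y'" for c
    using that lie_central_sym_bracket_cong[OF E] by blast
qed blast

text \<open>The map \<open>t\<close> may miss part of the middle term, but it reaches every point of
  the quotient, and a symmetrised bracket depends only on the points below its entries.\<close>

lemma ext_comm_eq_image:
  assumes E: "lie_central E" and t: "leibniz_hom F (ext_mid E) t"
    and surj: "surj (\<lambda>x. ext_proj E (t x))"
  shows "ext_comm E = t ` lie_commutator F UNIV UNIV"
proof
  interpret F: leibniz_algebra F by (rule leibniz_hom_source[OF t])
  interpret G: leibniz_algebra "ext_mid E" by (rule leibniz_hom_target[OF t])
  show "t ` lie_commutator F UNIV UNIV \<subseteq> ext_comm E"
    using leibniz_hom_lie_commutator[OF t F.ideal_UNIV] by auto
  show "ext_comm E \<subseteq> t ` lie_commutator F UNIV UNIV"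
  proof
    fix x assume "x \<in> ext_comm E"
    from this G.ideal_UNIV G.ideal_UNIV show "x \<in> t ` lie_commutator F UNIV UNIV"
    proof (induction rule: G.lie_commutator_induct)
      case zero
      show ?case
        by (rule image_eqI[of _ _ 0])
          (simp_all add: leibniz_hom_zero[OF t]
            ideal_zero[OF leibniz_hom_source[OF t] F.ideal_lie_commutator])
    next
      case (step c m n y)
      then obtain z where z: "y = t z" "z \<in> lie_commutator F UNIV UNIV" by blast
      obtain a b where "ext_proj E m = ext_proj E (t a)" "ext_proj E n = ext_proj E (t b)"
        using surj by (metis surjE)
      then have "sym_bracket (ext_mid E) m n = t (sym_bracket F a b)"
        using lie_central_sym_bracket_cong[OF E] leibniz_hom_sym_bracket[OF t] by metis
      then show ?case
        using z
        by (intro image_eqI[of _ _ "scale F c (sym_bracket F a b) + z"])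
          (auto simp: leibniz_homD[OF t] F.sym_bracket_in_lie_commutator
            intro!: idealD[OF leibniz_hom_source[OF t] F.ideal_lie_commutator])
    qed
  qed
qed

text \<open>Both Lie-commutators are images of that of \<open>F\<close>. Compatibility with the
  commutator maps prescribes \<open>\<xi>\<close> on symmetrised brackets, linearity carries this to
  their span, and injectivity of \<open>\<xi>\<close> gives the condition on zeros. For autoclinisms
  \<open>t2\<close> will be \<open>t1\<close> after an endomorphism of \<open>F\<close>; for two
  extensions of one algebra \<open>\<eta>\<close> will be the identity.\<close>

lemma lie_isoclinism_iff:
  assumes E1: "lie_central E1" and E2: "lie_central E2"
    and t1: "leibniz_hom F (ext_mid E1) t1" and t2: "leibniz_hom F (ext_mid E2) t2"
    and surj: "surj (\<lambda>x. ext_proj E1 (t1 x))"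
    and \<eta>: "leibniz_iso (ext_quot E1) (ext_quot E2) \<eta>"
    and t12: "\<And>x. ext_proj E2 (t2 x) = \<eta> (ext_proj E1 (t1 x))"
  shows "lie_isoclinism E1 E2 (\<eta>, \<xi>) \<longleftrightarrow> \<xi> \<in> extensional (ext_comm E1) \<and>
    (\<forall>x\<in>lie_commutator F UNIV UNIV. \<xi> (t1 x) = t2 x \<and> (t1 x = 0 \<longleftrightarrow> t2 x = 0))"
    (is "_ \<longleftrightarrow> _ \<and> (\<forall>x\<in>?C. _)")
proof -
  interpret F: leibniz_algebra F by (rule leibniz_hom_source[OF t1])
  note I = idealD[OF leibniz_hom_source[OF t1] F.ideal_lie_commutator[of UNIV UNIV]]
  note hom1 = leibniz_homD[OF t1] and hom2 = leibniz_homD[OF t2]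
  have "surj \<eta>" using \<eta> by (simp add: leibniz_iso_def bij_def)
  then have surj2: "surj (\<lambda>x. ext_proj E2 (t2 x))"
    using comp_surj[OF surj] by (simp add: t12 comp_def)
  have C1: "ext_comm E1 = t1 ` ?C" by (rule ext_comm_eq_image[OF E1 t1 surj])
  have C2: "ext_comm E2 = t2 ` ?C" by (rule ext_comm_eq_image[OF E2 t2 surj2])
  have cm1: "commutator_map E1 (ext_proj E1 (t1 a)) (ext_proj E1 (t1 b)) = t1 (sym_bracket F a b)"
    for a b by (simp add: commutator_map_eq[OF E1] hom1)
  have cm2: "commutator_map E2 (\<eta> (ext_proj E1 (t1 a))) (\<eta> (ext_proj E1 (t1 b)))
    = t2 (sym_bracket F a b)" for a b
    by (simp add: t12[symmetric] commutator_map_eq[OF E2] hom2)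
  have sym_in: "sym_bracket F a b \<in> ?C" for a b by (simp add: F.sym_bracket_in_lie_commutator)
  show ?thesis
  proof (intro iffI conjI)
    assume iso: "lie_isoclinism E1 E2 (\<eta>, \<xi>)"
    then show "\<xi> \<in> extensional (ext_comm E1)" by (simp add: lie_isoclinism_def)
    have inj: "inj_on \<xi> (t1 ` ?C)"
      and add: "\<And>x y. x \<in> ?C \<Longrightarrow> y \<in> ?C \<Longrightarrow> \<xi> (t1 x + t1 y) = \<xi> (t1 x) + \<xi> (t1 y)"
      and sc: "\<And>c x. x \<in> ?C \<Longrightarrow> \<xi> (scale (ext_mid E1) c (t1 x)) = scale (ext_mid E2) c (\<xi> (t1 x))"
      and cm: "\<And>a b. \<xi> (commutator_map E1 a b) = commutator_map E2 (\<eta> a) (\<eta> b)"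
      using iso by (auto simp: lie_isoclinism_def subalgebra_iso_def C1 bij_betw_def)
    have \<xi>0: "\<xi> (t1 0) = t2 0"
      using add[of 0 0] I by (simp add: leibniz_hom_zero[OF t1] leibniz_hom_zero[OF t2])
    have \<xi>: "\<xi> (t1 x) = t2 x" if "x \<in> ?C" for x
      using that F.ideal_UNIV F.ideal_UNIV
    proof (induction rule: F.lie_commutator_induct)
      case (step c m n y)
      have "\<xi> (t1 (scale F c (sym_bracket F m n)) + t1 y)
        = \<xi> (t1 (scale F c (sym_bracket F m n))) + \<xi> (t1 y)"
        using step by (intro add I sym_in)
      also have "\<xi> (t1 (scale F c (sym_bracket F m n))) = scale (ext_mid E2) c (\<xi> (t1 (sym_bracket F m n)))"
        using sc[OF sym_in] hom1(4) by metis
      also have "\<xi> (t1 (sym_bracket F m n)) = t2 (sym_bracket F m n)"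
        using cm cm1 cm2 by metis
      finally show ?case using step hom1(3) hom2(3,4) by metis
    qed (rule \<xi>0)
    have "t1 x = 0 \<longleftrightarrow> t2 x = 0" if x: "x \<in> ?C" for x
      using inj_on_eq_iff[OF inj imageI[OF x] imageI[OF I(1)]] \<xi>[OF x] \<xi>0
      by (simp add: leibniz_hom_zero[OF t1] leibniz_hom_zero[OF t2])
    with \<xi> show "\<forall>x\<in>?C. \<xi> (t1 x) = t2 x \<and> (t1 x = 0 \<longleftrightarrow> t2 x = 0)" by blast
  next
    assume R: "\<xi> \<in> extensional (ext_comm E1) \<and>
      (\<forall>x\<in>?C. \<xi> (t1 x) = t2 x \<and> (t1 x = 0 \<longleftrightarrow> t2 x = 0))"
    then have \<xi>: "\<xi> (t1 x) = t2 x" if "x \<in> ?C" for x using that by blast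
    have "inj_on \<xi> (t1 ` ?C)"
    proof (rule inj_onI, clarsimp simp: \<xi>)
      fix x y assume "x \<in> ?C" "y \<in> ?C" "t2 x = t2 y"
      then show "t1 x = t1 y"
        using R I(3)[of x y] leibniz_hom_diff[OF t1, of x y] leibniz_hom_diff[OF t2, of x y] by auto
    qed
    moreover have "\<xi> ` t1 ` ?C = t2 ` ?C" by (auto simp: \<xi> image_image)
    moreover have "\<xi> (t1 x + t1 y) = t2 x + t2 y"
      "\<xi> (scale (ext_mid E1) c (t1 x)) = scale (ext_mid E2) c (t2 x)"
      "\<xi> (bracket (ext_mid E1) (t1 x) (t1 y)) = bracket (ext_mid E2) (t2 x) (t2 y)"
      if "x \<in> ?C" "y \<in> ?C" for x y c
      using that I \<xi> hom1 hom2 by metis+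
    ultimately have "subalgebra_iso (ext_mid E1) (ext_comm E1) (ext_mid E2) (ext_comm E2) \<xi>"
      by (auto simp: subalgebra_iso_def C1 C2 bij_betw_def \<xi>)
    moreover have "\<xi> (commutator_map E1 a b) = commutator_map E2 (\<eta> a) (\<eta> b)" for a b
    proof -
      obtain x y where "a = ext_proj E1 (t1 x)" "b = ext_proj E1 (t1 y)" using surj by (metis surjE)
      then show ?thesis by (simp add: cm1 cm2 \<xi> sym_in)
    qed
    ultimately show "lie_isoclinism E1 E2 (\<eta>, \<xi>)"
      using R \<eta> by (simp add: lie_isoclinism_def)
  qed
qed

lemma lie_isoclinism_quot_iso:
  "lie_isoclinism E1 E2 (\<eta>, \<xi>) \<Longrightarrow> leibniz_iso (ext_quot E1) (ext_quot E2) \<eta>"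
  by (simp add: lie_isoclinism_def)

lemma lie_isoclinism_unique:
  assumes "lie_central E1" "lie_central E2"
    and "leibniz_hom F (ext_mid E1) t1" "leibniz_hom F (ext_mid E2) t2"
    and surj: "surj (\<lambda>x. ext_proj E1 (t1 x))"
    and "\<And>x. ext_proj E2 (t2 x) = \<eta> (ext_proj E1 (t1 x))"
    and iso: "lie_isoclinism E1 E2 (\<eta>, \<xi>)" "lie_isoclinism E1 E2 (\<eta>, \<xi>')"
  shows "\<xi> = \<xi>'"
proof -
  note \<eta> = lie_isoclinism_quot_iso[OF iso(1)]
  note iff = lie_isoclinism_iff[OF assms(1-5) \<eta> assms(6)]
  \<comment> \<open>Both maps are \<open>undefined\<close> outside the Lie-commutator, and on it
    both send \<open>t1 x\<close> to \<open>t2 x\<close>.\<close>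
  show ?thesis
  proof (rule extensionalityI)
    show "\<xi> \<in> extensional (ext_comm E1)" "\<xi>' \<in> extensional (ext_comm E1)" using iso iff by auto
    show "\<xi> x = \<xi>' x" if "x \<in> ext_comm E1" for x
      using that iso iff ext_comm_eq_image[OF assms(1,3) surj] by auto
  qed
qed

lemma lie_isoclinism_exists_iff:
  assumes "lie_central E1" "lie_central E2"
    and t1: "leibniz_hom F (ext_mid E1) t1" and t2: "leibniz_hom F (ext_mid E2) t2"
    and surj: "surj (\<lambda>x. ext_proj E1 (t1 x))"
    and \<eta>: "leibniz_iso (ext_quot E1) (ext_quot E2) \<eta>"
    and "\<And>x. ext_proj E2 (t2 x) = \<eta> (ext_proj E1 (t1 x))"
  shows "(\<exists>\<xi>. lie_isoclinism E1 E2 (\<eta>, \<xi>)) \<longleftrightarrow>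
    (\<forall>x\<in>lie_commutator F UNIV UNIV. t1 x = 0 \<longleftrightarrow> t2 x = 0)" (is "_ \<longleftrightarrow> (\<forall>x\<in>?C. _)")
proof
  note iff = lie_isoclinism_iff[OF assms]
  show "\<forall>x\<in>?C. t1 x = 0 \<longleftrightarrow> t2 x = 0" if "\<exists>\<xi>. lie_isoclinism E1 E2 (\<eta>, \<xi>)"
    using that iff by blast
  assume K: "\<forall>x\<in>?C. t1 x = 0 \<longleftrightarrow> t2 x = 0"
  interpret F: leibniz_algebra F by (rule leibniz_hom_source[OF t1])
  \<comment> \<open>A preimage under \<open>t1\<close> is chosen and pushed forward by
    \<open>t2\<close>; the restriction provides the default value that extensionality asks
    for.\<close>
  define \<xi> where "\<xi> = restrict (\<lambda>y. t2 (inv_into ?C t1 y)) (ext_comm E1)"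
  have "\<xi> (t1 x) = t2 x" if x: "x \<in> ?C" for x
  proof -
    define x' where "x' = inv_into ?C t1 (t1 x)"
    have x': "x' \<in> ?C" "t1 x' = t1 x"
      unfolding x'_def using x by (auto intro: inv_into_into f_inv_into_f)
    \<comment> \<open>Two preimages of one value differ by an element killed by \<open>t1\<close>,
      hence by \<open>t2\<close>, so the choice is immaterial.\<close>
    then have "t2 (x' - x) = 0"
      using K x ideal_diff[OF leibniz_hom_source[OF t1] F.ideal_lie_commutator]
        leibniz_hom_diff[OF t1, of x' x] by auto
    then have "t2 x' = t2 x" by (simp add: leibniz_hom_diff[OF t2])
    then show ?thesis
      using x ext_comm_eq_image[OF assms(1) t1 surj] by (simp add: \<xi>_def x'_def)
  qed
  then have "lie_isoclinism E1 E2 (\<eta>, \<xi>)" using K iff by (simp add: \<xi>_def)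
  then show "\<exists>\<xi>. lie_isoclinism E1 E2 (\<eta>, \<xi>)" by blast
qed

section \<open>The induced map on the second Lie-homology and the kernel of \<open>\<theta>\<close>\<close>

lemma mem_coset_iff: "z \<in> coset J x \<longleftrightarrow> z - x \<in> J"
  by (auto simp: coset_def intro: image_eqI[of _ _ "z - x"])

lemma coset_eq_iff:
  assumes "leibniz_algebra L" "ideal L J"
  shows "coset J x = coset J y \<longleftrightarrow> x - y \<in> J"
proof
  note I = idealD[OF assms]
  assume "coset J x = coset J y"
  then have "x \<in> coset J y" using I(1) mem_coset_iff[of x J x] by simp
  then show "x - y \<in> J" by (simp add: mem_coset_iff)
next
  note I = idealD[OF assms]
  assume d: "x - y \<in> J"
  have "z - x \<in> J \<longleftrightarrow> z - y \<in> J" for z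
    using I(2)[OF _ d, of "z - x"] I(3)[OF _ d, of "z - y"] by auto
  then show "coset J x = coset J y" by (auto simp: mem_coset_iff)
qed

section \<open>A fixed free presentation and lifts of endomorphisms of the quotient\<close>

locale presentation =
  fixes F :: "('k::field, 'f::ab_group_add) leibniz" and \<rho> :: "'f \<Rightarrow> 'q::ab_group_add"
    and Q :: "('k, 'q) leibniz"
  assumes free_presentation: "free_presentation F \<rho> Q"
begin

abbreviation FF :: "'f set" where "FF \<equiv> lie_commutator F UNIV UNIV"
abbreviation RF :: "'f set" where "RF \<equiv> lie_commutator F (rel_ker \<rho>) UNIV"

lemma rho: "leibniz_hom F Q \<rho>" "surj \<rho>"
  using free_presentation by (auto simp: free_presentation_def)

sublocale F: leibniz_algebra F
  by (rule leibniz_hom_source[OF rho(1)])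

lemmas RF_ideal = idealD[OF F.leibniz_algebra_axioms F.ideal_lie_commutator[of "rel_ker \<rho>" UNIV]]
lemmas coset_RF_eq_iff = coset_eq_iff[OF F.leibniz_algebra_axioms F.ideal_lie_commutator]

lemma RF_subset: "x \<in> RF \<Longrightarrow> x \<in> FF"
  using F.lie_commutator_mono[of "rel_ker \<rho>" UNIV UNIV UNIV] by auto

text \<open>This serves for endomorphisms of \<open>F\<close>, with \<open>p\<close> equal to
  \<open>\<rho>\<close>, and for maps into an extension, with \<open>p\<close> its projection and
  \<open>f\<close> the identity.\<close>

lemma lift_exists:
  assumes "leibniz_hom Q N f" "leibniz_hom M N p" "surj p"
  shows "\<exists>t. leibniz_hom F M t \<and> (\<forall>x. p (t x) = f (\<rho> x))"
proof -
  obtain X where "free_leibniz_on F X" using free_presentation by (auto simp: free_presentation_def)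
  from free_leibniz_lift[OF this leibniz_hom_comp[OF rho(1) assms(1)] assms(2,3)]
  show ?thesis by (metis comp_apply)
qed

lemmas endo_lift_exists = lift_exists[OF _ rho]

lemma ext_lift_exists:
  assumes "lie_central E" "ext_quot E = Q"
  shows "\<exists>t. leibniz_hom F (ext_mid E) t \<and> (\<forall>x. ext_proj E (t x) = \<rho> x)"
  using lift_exists[OF leibniz_hom_id[OF leibniz_hom_target[OF rho(1)]], of "ext_mid E" "ext_proj E"]
    lie_central_proj_hom[OF assms(1)] lie_central_surj[OF assms(1)] assms(2) by simp

lemma lift_RF:
  assumes h: "leibniz_hom F F h" "\<And>x. \<rho> (h x) = \<eta> (\<rho> x)" and \<eta>: "leibniz_hom Q Q \<eta>"
    and x: "x \<in> RF"
  shows "h x \<in> RF"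
  using x
  by (rule leibniz_hom_lie_commutator[OF h(1) ideal_rel_ker[OF rho(1)], rotated])
    (simp add: h(2) leibniz_hom_zero[OF \<eta>])

lemma lift_FF: "leibniz_hom F F h \<Longrightarrow> x \<in> FF \<Longrightarrow> h x \<in> FF"
  by (rule leibniz_hom_lie_commutator[OF _ F.ideal_UNIV]) auto

text \<open>On \<open>FF\<close>, another lift moves the value by an element of \<open>RF\<close>,
  because two lifts differ by elements of the kernel of \<open>\<rho>\<close>; another
  representative does so because lifts preserve \<open>RF\<close>.\<close>

lemma HL2_map_coset:
  assumes h: "leibniz_hom F F h" "\<And>x. \<rho> (h x) = \<eta> (\<rho> x)" and \<eta>: "leibniz_hom Q Q \<eta>"
    and x: "x \<in> FF"
  shows "HL2_map F \<rho> F \<rho> \<eta> (coset RF x) = coset RF (h x)"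
  unfolding HL2_map_def
proof (rule the_equality)
  show "\<exists>t y. leibniz_hom F F t \<and> (\<forall>y. \<rho> (t y) = \<eta> (\<rho> y)) \<and> y \<in> coset RF x \<and>
      coset RF (h x) = coset RF (t y)"
    using h by (intro exI[of _ h] exI[of _ x]) (auto simp: mem_coset_iff RF_ideal)
next
  fix d assume "\<exists>t y. leibniz_hom F F t \<and> (\<forall>y. \<rho> (t y) = \<eta> (\<rho> y)) \<and> y \<in> coset RF x \<and>
      d = coset RF (t y)"
  then obtain t y where t: "leibniz_hom F F t" "\<And>y. \<rho> (t y) = \<eta> (\<rho> y)"
    and y: "y - x \<in> RF" and d: "d = coset RF (t y)" by (auto simp: mem_coset_iff)
  have "t x - h x \<in> RF"
    by (rule leibniz_hom_diff_lie_commutator[OF t(1) h(1) _ x])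
      (simp add: leibniz_hom_diff[OF rho(1)] t h)
  moreover have "t (y - x) \<in> RF" by (rule lift_RF[OF t \<eta> y])
  \<comment> \<open>The sum is \<open>t y - h x\<close>: a change of representative and a change of
    lift.\<close>
  ultimately have "t (y - x) + (t x - h x) \<in> RF" by (intro RF_ideal(2))
  then show "d = coset RF (h x)"
    unfolding d coset_RF_eq_iff by (simp add: leibniz_hom_diff[OF t(1)])
qed

text \<open>\<open>h' \<circ> h\<close> need not be the identity, but like \<open>id\<close> it
  lifts the identity of \<open>Q\<close>, so on \<open>FF\<close> the two agree up to
  \<open>RF\<close>.\<close>

lemma lift_inverse:
  assumes h: "leibniz_hom F F h" "\<And>x. \<rho> (h x) = \<eta> (\<rho> x)"
    and h': "leibniz_hom F F h'" "\<And>x. \<rho> (h' x) = \<eta>' (\<rho> x)"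
    and inv: "\<And>q. \<eta>' (\<eta> q) = q" and x: "x \<in> FF"
  shows "h' (h x) - x \<in> RF"
  using leibniz_hom_diff_lie_commutator[OF leibniz_hom_comp[OF h(1) h'(1)]
      leibniz_hom_id[OF F.leibniz_algebra_axioms] _ x, of "rel_ker \<rho>"]
  by (simp add: leibniz_hom_diff[OF rho(1)] h h' inv)

text \<open>A lift of the inverse automorphism brings \<open>h x\<close> back to \<open>x\<close> up
  to \<open>RF\<close>. Thus the map induced on \<open>FF\<close> modulo \<open>RF\<close> is
  injective.\<close>

lemma iso_lift_RF_iff:
  assumes h: "leibniz_hom F F h" "\<And>x. \<rho> (h x) = \<eta> (\<rho> x)" and \<eta>: "leibniz_iso Q Q \<eta>"
    and x: "x \<in> FF"
  shows "h x \<in> RF \<longleftrightarrow> x \<in> RF"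
proof
  have hom: "leibniz_hom Q Q \<eta>" using \<eta> by (simp add: leibniz_iso_def)
  show "h x \<in> RF" if "x \<in> RF" by (rule lift_RF[OF h hom that])
  assume hx: "h x \<in> RF"
  obtain \<eta>' where \<eta>': "leibniz_hom Q Q \<eta>'"
    and inv: "\<And>q. \<eta>' (\<eta> q) = q" "\<And>q. \<eta> (\<eta>' q) = q"
    using leibniz_iso_inverse[OF \<eta>] by blast
  obtain h' where h': "leibniz_hom F F h'" "\<And>x. \<rho> (h' x) = \<eta>' (\<rho> x)"
    using endo_lift_exists[OF \<eta>'] by blast
  have "h' (h x) - x \<in> RF"
    by (rule lift_inverse[OF h h' inv(1) x])
  then have "h' (h x) - (h' (h x) - x) \<in> RF" by (rule RF_ideal(3)[OF lift_RF[OF h' \<eta>' hx]])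
  then show "x \<in> RF" by simp
qed

end

section \<open>A Lie-central extension with a chosen lift of the presentation\<close>

locale presented_extension = presentation F \<rho> Q
  for F :: "('k::field, 'f::ab_group_add) leibniz" and \<rho> :: "'f \<Rightarrow> 'q::ab_group_add"
    and Q :: "('k, 'q) leibniz" +
  fixes E :: "('k, 'n::ab_group_add, 'g::ab_group_add, 'q) extension"
    and t :: "'f \<Rightarrow> 'g"
  assumes central: "lie_central E" and quot: "ext_quot E = Q"
    and t: "leibniz_hom F (ext_mid E) t" and proj_t: "ext_proj E (t x) = \<rho> x"
begin

lemma surj_proj_t: "surj (\<lambda>x. ext_proj E (t x))"
  using rho(2) by (simp add: proj_t)

text \<open>\<open>t\<close> maps the kernel of \<open>\<rho>\<close> into that of the projection,
  whose Lie-commutator with the middle term vanishes.\<close>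

lemma t_RF: "x \<in> RF \<Longrightarrow> t x = 0"
  by (rule lie_central_commutator_zero[OF central])
    (erule leibniz_hom_lie_commutator[OF t ideal_rel_ker[OF rho(1)], rotated], simp add: proj_t)

lemma t_zero_rho: "t x = 0 \<Longrightarrow> \<rho> x = 0"
  using proj_t[of x] leibniz_hom_zero[OF lie_central_proj_hom[OF central]] by simp

text \<open>Any other lift agrees with \<open>t\<close> on \<open>FF\<close>, since the difference
  lands in a vanishing Lie-commutator; and \<open>t\<close> kills \<open>RF\<close>, so the
  representative does not matter either.\<close>

lemma incl_theta:
  assumes x: "\<rho> x = 0" "x \<in> FF"
  shows "ext_incl E (theta F \<rho> E (coset RF x)) = t x"
proof -
  have "t x \<in> range (ext_incl E)"
    unfolding lie_central_range[OF central] by (simp add: proj_t x)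
  then obtain n where n: "ext_incl E n = t x" by auto
  have "theta F \<rho> E (coset RF x) = n"
    unfolding theta_def
  proof (rule the_equality)
    show "\<exists>s y. leibniz_hom F (ext_mid E) s \<and> (\<forall>y. ext_proj E (s y) = \<rho> y) \<and> y \<in> coset RF x \<and>
        ext_incl E n = s y"
      using n by (intro exI[of _ t] exI[of _ x]) (auto simp: mem_coset_iff RF_ideal t proj_t)
  next
    fix m assume "\<exists>s y. leibniz_hom F (ext_mid E) s \<and> (\<forall>y. ext_proj E (s y) = \<rho> y) \<and>
        y \<in> coset RF x \<and> ext_incl E m = s y"
    then obtain s y where s: "leibniz_hom F (ext_mid E) s" "\<And>y. ext_proj E (s y) = \<rho> y"
      and y: "y - x \<in> RF" and m: "ext_incl E m = s y" by (auto simp: mem_coset_iff)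
    \<comment> \<open>The other representative must lie in \<open>FF\<close> for the comparison of
      two lifts to apply to it.\<close>
    have "y - x + x \<in> FF"
      by (rule ideal_add[OF F.leibniz_algebra_axioms F.ideal_lie_commutator RF_subset[OF y] x(2)])
    then have "s y - t y \<in> lie_commutator (ext_mid E) (rel_ker (ext_proj E)) UNIV"
      by (intro leibniz_hom_diff_lie_commutator[OF s(1) t])
        (simp_all add: s proj_t leibniz_hom_diff[OF lie_central_proj_hom[OF central]])
    then have "s y = t y" using lie_central_commutator_zero[OF central] by force
    moreover have "t y = t x" using t_RF[OF y] by (simp add: leibniz_hom_diff[OF t])
    ultimately have "ext_incl E m = ext_incl E n" using m n by simp
    then show "m = n" using lie_central_inj[OF central] by (simp add: inj_eq)
  qed
  with n show ?thesis by simp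
qed

lemma theta_coset_eq_iff:
  assumes "\<rho> x = 0" "x \<in> FF" "\<rho> y = 0" "y \<in> FF"
  shows "theta F \<rho> E (coset RF x) = theta F \<rho> E (coset RF y) \<longleftrightarrow> t x = t y"
  unfolding incl_theta[OF assms(1,2), symmetric] incl_theta[OF assms(3,4), symmetric]
  using lie_central_inj[OF central] by (simp add: inj_eq)

text \<open>As the inclusion is injective, \<open>theta\<close> vanishes exactly where
  \<open>t\<close> does; moreover \<open>t x = 0\<close> entails
  \<open>\<rho> x = 0\<close>.\<close>

lemma ker_theta_eq: "ker_theta F \<rho> E = coset RF ` {x \<in> FF. t x = 0}"
proof -
  have "theta F \<rho> E (coset RF x) = 0 \<longleftrightarrow> t x = 0" if "\<rho> x = 0" "x \<in> FF" for x
    using incl_theta[OF that] lie_central_inj[OF central]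
      leibniz_hom_zero[OF lie_central_incl_hom[OF central]] by (metis inj_eq)
  then show ?thesis
    using t_zero_rho by (auto simp: ker_theta_def HL2_def)
qed

lemma coset_mem_ker_theta_iff:
  assumes "x \<in> FF"
  shows "coset RF x \<in> ker_theta F \<rho> E \<longleftrightarrow> t x = 0"
proof
  assume "coset RF x \<in> ker_theta F \<rho> E"
  then obtain y where "t y = 0" "x - y \<in> RF" by (auto simp: ker_theta_eq coset_RF_eq_iff)
  then show "t x = 0" using t_RF[of "x - y"] by (simp add: leibniz_hom_diff[OF t])
qed (use assms in \<open>auto simp: ker_theta_eq\<close>)

text \<open>That the image lies in the kernel means that \<open>h\<close> preserves the zeros of
  \<open>t\<close>. That \<open>h\<close> reflects them uses the reverse inclusion and injectivity
  modulo \<open>RF\<close>; conversely, a lift of the inverse automorphism supplies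
  preimages.\<close>

lemma HL2_map_ker_theta_iff:
  assumes \<eta>: "leibniz_iso Q Q \<eta>" and h: "leibniz_hom F F h" "\<And>x. \<rho> (h x) = \<eta> (\<rho> x)"
  shows "HL2_map F \<rho> F \<rho> \<eta> ` ker_theta F \<rho> E = ker_theta F \<rho> E \<longleftrightarrow>
    (\<forall>x\<in>FF. t x = 0 \<longleftrightarrow> t (h x) = 0)" (is "?img = ?ker \<longleftrightarrow> _")
proof -
  have hom: "leibniz_hom Q Q \<eta>" using \<eta> by (simp add: leibniz_iso_def)
  obtain \<eta>' where \<eta>': "leibniz_hom Q Q \<eta>'"
    and inv: "\<And>q. \<eta>' (\<eta> q) = q" "\<And>q. \<eta> (\<eta>' q) = q"
    using leibniz_iso_inverse[OF \<eta>] by blast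
  obtain h' where h': "leibniz_hom F F h'" "\<And>x. \<rho> (h' x) = \<eta>' (\<rho> x)"
    using endo_lift_exists[OF \<eta>'] by blast
  have img: "?img = (\<lambda>x. coset RF (h x)) ` {x \<in> FF. t x = 0}"
    by (auto simp: ker_theta_eq HL2_map_coset[OF h hom] image_iff)
  note diff = ideal_diff[OF F.leibniz_algebra_axioms F.ideal_lie_commutator]
  show ?thesis
  proof
    assume eq: "?img = ?ker"
    show "\<forall>x\<in>FF. t x = 0 \<longleftrightarrow> t (h x) = 0"
    proof (intro ballI iffI)
      fix x assume x: "x \<in> FF"
      assume "t x = 0"
      then have "coset RF (h x) \<in> ?img" unfolding img using x by blast
      then have "coset RF (h x) \<in> ?ker" unfolding eq .
      then show "t (h x) = 0" using coset_mem_ker_theta_iff lift_FF[OF h(1) x] by blast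
    next
      fix x assume x: "x \<in> FF"
      assume "t (h x) = 0"
      then have "coset RF (h x) \<in> ?img"
        unfolding eq using coset_mem_ker_theta_iff lift_FF[OF h(1) x] by blast
      then obtain y where y: "y \<in> FF" "t y = 0" "h x - h y \<in> RF"
        by (auto simp: img coset_RF_eq_iff)
      have "x - y \<in> RF"
        using iso_lift_RF_iff[OF h \<eta> diff[OF x y(1)]] y by (simp add: leibniz_hom_diff[OF h(1)])
      then show "t x = 0" using t_RF[of "x - y"] y by (simp add: leibniz_hom_diff[OF t])
    qed
  next
    assume K: "\<forall>x\<in>FF. t x = 0 \<longleftrightarrow> t (h x) = 0"
    show "?img = ?ker"
    proof
      have "coset RF (h x) \<in> ?ker" if "x \<in> FF" "t x = 0" for x
        using that K coset_mem_ker_theta_iff[OF lift_FF[OF h(1) that(1)]] by blast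
      then show "?img \<subseteq> ?ker" unfolding img by blast
      show "?ker \<subseteq> ?img"
      proof
        fix c assume "c \<in> ?ker"
        then obtain y where y: "y \<in> FF" "t y = 0" "c = coset RF y" by (auto simp: ker_theta_eq)
        \<comment> \<open>\<open>h' y\<close> represents a preimage of the class of
          \<open>y\<close>; reflection of zeros will show that \<open>t\<close> kills it.\<close>
        have d: "h (h' y) - y \<in> RF"
          by (rule lift_inverse[OF h' h inv(2) y(1)])
        then have "t (h (h' y)) = 0" using t_RF[OF d] y by (simp add: leibniz_hom_diff[OF t])
        then have "t (h' y) = 0" using K lift_FF[OF h'(1) y(1)] by blast
        moreover have "coset RF (h (h' y)) = c" using d by (simp add: y(3) coset_RF_eq_iff)
        ultimately show "c \<in> ?img" unfolding img using lift_FF[OF h'(1) y(1)] by blast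
      qed
    qed
  qed
qed

section \<open>Autoclinisms and quasi Lie-trivial extensions\<close>

lemma autoclinism_exists_iff:
  assumes \<eta>: "leibniz_iso Q Q \<eta>" and h: "leibniz_hom F F h" "\<And>x. \<rho> (h x) = \<eta> (\<rho> x)"
  shows "(\<exists>\<xi>. lie_isoclinism E E (\<eta>, \<xi>)) \<longleftrightarrow> (\<forall>x\<in>FF. t x = 0 \<longleftrightarrow> t (h x) = 0)"
proof -
  \<comment> \<open>The maps to compare are \<open>t\<close> and \<open>t \<circ> h\<close>, the
    latter lying over \<open>\<eta>\<close>.\<close>
  have "ext_proj E ((t \<circ> h) x) = \<eta> (ext_proj E (t x))" for x by (simp add: proj_t h(2))
  from lie_isoclinism_exists_iff[OF central central t leibniz_hom_comp[OF h(1) t] surj_proj_t _ this]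
  show ?thesis using \<eta> by (simp add: quot)
qed

lemma autoclinism_unique:
  assumes "lie_isoclinism E E (\<eta>, \<xi>)" "lie_isoclinism E E (\<eta>, \<xi>')"
  shows "\<xi> = \<xi>'"
proof -
  have \<eta>: "leibniz_hom Q Q \<eta>"
    using lie_isoclinism_quot_iso[OF assms(1)] unfolding leibniz_iso_def quot ..
  obtain h where h: "leibniz_hom F F h" "\<And>x. \<rho> (h x) = \<eta> (\<rho> x)"
    using endo_lift_exists[OF \<eta>] by blast
  have "ext_proj E ((t \<circ> h) x) = \<eta> (ext_proj E (t x))" for x by (simp add: proj_t h(2))
  from lie_isoclinism_unique[OF central central t leibniz_hom_comp[OF h(1) t] surj_proj_t this assms]
  show ?thesis .
qed

text \<open>The first projection respects composition and is injective because \<open>\<eta>\<close>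
  determines \<open>\<xi>\<close>. The set \<open>A\<close> is abstract so that it can be the
  stabilizer of the kernel or the whole automorphism group.\<close>

lemma Autcl_iso:
  assumes "\<And>\<eta>. \<eta> \<in> A \<longleftrightarrow> leibniz_iso Q Q \<eta> \<and> (\<exists>\<xi>. lie_isoclinism E E (\<eta>, \<xi>))"
  shows "Autcl E \<cong> (Aut Q)\<lparr>carrier := A\<rparr>"
proof -
  have "fst ` carrier (Autcl E) = A"
    using assms lie_isoclinism_quot_iso[of E E] by (force simp: Autcl_def quot)
  moreover have "inj_on fst (carrier (Autcl E))"
    using autoclinism_unique by (auto simp: inj_on_def Autcl_def)
  ultimately have "fst \<in> iso (Autcl E) ((Aut Q)\<lparr>carrier := A\<rparr>)"
    by (auto simp: iso_def hom_def bij_betw_def Autcl_def Aut_def)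
  then show ?thesis by (auto simp: is_iso_def)
qed

text \<open>Injectivity of \<open>theta\<close> identifies the class of \<open>x\<close> with that
  of zero. Thus the kernel of \<open>t\<close> on \<open>FF\<close> depends on the presentation
  alone, not on the extension.\<close>

lemma quasi_lie_trivial_kernel:
  assumes "quasi_lie_trivial F \<rho> E" "x \<in> FF"
  shows "t x = 0 \<longleftrightarrow> x \<in> RF"
proof
  assume tx: "t x = 0"
  have 0: "0 \<in> FF" by (rule ideal_zero[OF F.leibniz_algebra_axioms F.ideal_lie_commutator])
  have HL2: "coset RF y \<in> HL2 F \<rho>" if "\<rho> y = 0" "y \<in> FF" for y
    using that by (auto simp: HL2_def)
  have "theta F \<rho> E (coset RF x) = theta F \<rho> E (coset RF 0)"
    using theta_coset_eq_iff[of x 0] tx t_zero_rho assms(2) 0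
    by (simp add: leibniz_hom_zero[OF t] leibniz_hom_zero[OF rho(1)])
  then have "coset RF x = coset RF 0"
    using assms(1) HL2[of x] HL2[of 0] t_zero_rho[OF tx] assms(2) 0
    by (auto simp: quasi_lie_trivial_def leibniz_hom_zero[OF rho(1)] dest: inj_onD)
  then show "x \<in> RF" by (simp add: coset_RF_eq_iff)
qed (rule t_RF)

lemma Autcl_iso_stabilizer:
  "Autcl E \<cong> (Aut Q)\<lparr>carrier :=
    {\<eta> \<in> carrier (Aut Q). HL2_map F \<rho> F \<rho> \<eta> ` ker_theta F \<rho> E = ker_theta F \<rho> E}\<rparr>"
proof (rule Autcl_iso)
  fix \<eta>
  have "HL2_map F \<rho> F \<rho> \<eta> ` ker_theta F \<rho> E = ker_theta F \<rho> E
      \<longleftrightarrow> (\<exists>\<xi>. lie_isoclinism E E (\<eta>, \<xi>))" if \<eta>: "leibniz_iso Q Q \<eta>"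
  proof -
    have hom: "leibniz_hom Q Q \<eta>" using \<eta> by (simp add: leibniz_iso_def)
    obtain h where h: "leibniz_hom F F h" "\<And>x. \<rho> (h x) = \<eta> (\<rho> x)"
      using endo_lift_exists[OF hom] by blast
    show ?thesis
      by (simp only: HL2_map_ker_theta_iff[OF \<eta> h] autoclinism_exists_iff[OF \<eta> h])
  qed
  then show "\<eta> \<in> {\<eta> \<in> carrier (Aut Q). HL2_map F \<rho> F \<rho> \<eta> ` ker_theta F \<rho> E = ker_theta F \<rho> E} \<longleftrightarrow>
      leibniz_iso Q Q \<eta> \<and> (\<exists>\<xi>. lie_isoclinism E E (\<eta>, \<xi>))"
    by (auto simp: Aut_def)
qed

text \<open>The kernel of \<open>t\<close> on \<open>FF\<close> is now \<open>RF\<close>, and every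
  lift of an automorphism preserves and reflects membership in \<open>RF\<close>.\<close>

lemma Autcl_iso_Aut:
  assumes "quasi_lie_trivial F \<rho> E"
  shows "Autcl E \<cong> Aut Q"
proof -
  have "Autcl E \<cong> (Aut Q)\<lparr>carrier := carrier (Aut Q)\<rparr>"
  proof (rule Autcl_iso)
    fix \<eta>
    have "\<exists>\<xi>. lie_isoclinism E E (\<eta>, \<xi>)" if \<eta>: "leibniz_iso Q Q \<eta>"
    proof -
      have hom: "leibniz_hom Q Q \<eta>" using \<eta> by (simp add: leibniz_iso_def)
      obtain h where h: "leibniz_hom F F h" "\<And>x. \<rho> (h x) = \<eta> (\<rho> x)"
        using endo_lift_exists[OF hom] by blast
      show ?thesis
        unfolding autoclinism_exists_iff[OF \<eta> h]
        by (simp add: quasi_lie_trivial_kernel[OF assms] iso_lift_RF_iff[OF h \<eta>] lift_FF[OF h(1)])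
    qed
    then show "\<eta> \<in> carrier (Aut Q) \<longleftrightarrow> leibniz_iso Q Q \<eta> \<and> (\<exists>\<xi>. lie_isoclinism E E (\<eta>, \<xi>))"
      by (auto simp: Aut_def)
  qed
  then show ?thesis by simp
qed

end

text \<open>The lifts into both middle terms have the same kernel \<open>RF\<close> on
  \<open>FF\<close>, which is the criterion for an isoclinism over the identity of
  \<open>Q\<close>.\<close>

lemma quasi_lie_trivial_isoclinic:
  assumes pres: "free_presentation F \<rho> Q"
    and E1: "quasi_lie_trivial F \<rho> E1" "ext_quot E1 = Q"
    and E2: "quasi_lie_trivial F \<rho> E2" "ext_quot E2 = Q"
  shows "lie_isoclinic E1 E2"
proof -
  interpret presentation F \<rho> Q by (rule presentation.intro[OF pres])
  have central: "lie_central E1" "lie_central E2"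
    using E1(1) E2(1) unfolding quasi_lie_trivial_def by blast+
  obtain t1 where t1: "leibniz_hom F (ext_mid E1) t1" "\<And>x. ext_proj E1 (t1 x) = \<rho> x"
    using ext_lift_exists[OF central(1) E1(2)] by blast
  obtain t2 where t2: "leibniz_hom F (ext_mid E2) t2" "\<And>x. ext_proj E2 (t2 x) = \<rho> x"
    using ext_lift_exists[OF central(2) E2(2)] by blast
  interpret E1: presented_extension F \<rho> Q E1 t1 by unfold_locales (fact central E1 t1)+
  interpret E2: presented_extension F \<rho> Q E2 t2 by unfold_locales (fact central E2 t2)+
  have "leibniz_iso Q Q id"
    using leibniz_hom_id[OF leibniz_hom_target[OF rho(1)]] by (simp add: leibniz_iso_def)
  then have iso: "leibniz_iso (ext_quot E1) (ext_quot E2) id" by (simp add: E1(2) E2(2))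
  have "ext_proj E2 (t2 x) = id (ext_proj E1 (t1 x))" for x by (simp add: t1(2) t2(2))
  note exists_iff = lie_isoclinism_exists_iff[OF central t1(1) t2(1) E1.surj_proj_t iso this]
  have "\<forall>x\<in>FF. t1 x = 0 \<longleftrightarrow> t2 x = 0"
    by (simp add: E1.quasi_lie_trivial_kernel[OF E1(1)] E2.quasi_lie_trivial_kernel[OF E2(1)])
  then show ?thesis unfolding lie_isoclinic_def exists_iff[symmetric] by blast
qed

theorem corollary4p4:
  fixes Q :: "('k::field, 'q::ab_group_add) leibniz"
    and F :: "('k, 'f::ab_group_add) leibniz"
    and \<rho> :: "'f \<Rightarrow> 'q"
    and E :: "('k, 'n::ab_group_add, 'g::ab_group_add, 'q) extension"
    and E1 :: "('k, 'n1::ab_group_add, 'g1::ab_group_add, 'q) extension"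
    and E2 :: "('k, 'n2::ab_group_add, 'g2::ab_group_add, 'q) extension"
  assumes "(2::'k) \<noteq> 0"
    and "free_presentation F \<rho> Q"
  shows "(lie_central E \<and> ext_quot E = Q \<longrightarrow>
      Autcl E \<cong>
        (Aut Q)\<lparr>carrier :=
          {\<eta> \<in> carrier (Aut Q). HL2_map F \<rho> F \<rho> \<eta> ` ker_theta F \<rho> E = ker_theta F \<rho> E}\<rparr>)
    \<and> (quasi_lie_trivial F \<rho> E \<and> ext_quot E = Q \<longrightarrow> Autcl E \<cong> Aut Q)
    \<and> (quasi_lie_trivial F \<rho> E1 \<and> ext_quot E1 = Q \<and>
       quasi_lie_trivial F \<rho> E2 \<and> ext_quot E2 = Q \<longrightarrow> lie_isoclinic E1 E2)"
proof (intro conjI impI; (elim conjE)?)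
  interpret presentation F \<rho> Q by (rule presentation.intro[OF assms(2)])
  assume E: "lie_central E" "ext_quot E = Q"
  \<comment> \<open>The lift does not occur in the claim; it is chosen to compute
    \<open>theta\<close> and the autoclinisms.\<close>
  obtain t where t: "leibniz_hom F (ext_mid E) t" "\<And>x. ext_proj E (t x) = \<rho> x"
    using ext_lift_exists[OF E] by blast
  interpret presented_extension F \<rho> Q E t by unfold_locales (fact E t)+
  show "Autcl E \<cong> (Aut Q)\<lparr>carrier :=
      {\<eta> \<in> carrier (Aut Q). HL2_map F \<rho> F \<rho> \<eta> ` ker_theta F \<rho> E = ker_theta F \<rho> E}\<rparr>"
    by (rule Autcl_iso_stabilizer)
next
  interpret presentation F \<rho> Q by (rule presentation.intro[OF assms(2)])
  assume E: "quasi_lie_trivial F \<rho> E" "ext_quot E = Q"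
  from E(1) have "lie_central E" by (simp add: quasi_lie_trivial_def)
  obtain t where t: "leibniz_hom F (ext_mid E) t" "\<And>x. ext_proj E (t x) = \<rho> x"
    using ext_lift_exists[OF \<open>lie_central E\<close> E(2)] by blast
  interpret presented_extension F \<rho> Q E t by unfold_locales (fact E t \<open>lie_central E\<close>)+
  show "Autcl E \<cong> Aut Q" by (rule Autcl_iso_Aut[OF E(1)])
next
  show "quasi_lie_trivial F \<rho> E1 \<Longrightarrow> ext_quot E1 = Q \<Longrightarrow>
      quasi_lie_trivial F \<rho> E2 \<Longrightarrow> ext_quot E2 = Q \<Longrightarrow> lie_isoclinic E1 E2"
    by (rule quasi_lie_trivial_isoclinic[OF assms(2)])
qed

end
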